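(* Let $U\subset\mathbb{R}^n$ be open, let $X_1,\dots,X_r$ be linearly independent real-valued smooth vector fields over $U$, let $\mathcal D$ be the $C^\infty(U)$-module (over real-valued functions) of real vector fields generated by $X_1,\dots,X_r$, and let $p_0\in U$. Let $f,g$ be germs of (complex-valued) smooth functions at $p_0$. Then: (1) $\nu_{\mathcal D}(fg)(p_0)=\nu_{\mathcal D}(f)(p_0)+\nu_{\mathcal D}(g)(p_0)$. (2) If $0\le f\le g$ (so $f,g$ are real-valued) and $g(p_0)=f(p_0)$, then $\nu_{\mathcal D}(f)(p_0)\ge \nu_{\mathcal D}(g)(p_0)$. (3) If $f\ge 0$ (so $f$ is real-valued), then $\nu_{\mathcal D}(f)(p_0)$ is an even number or infinity.
   Context: Linear independence means that $X_1|_q,\dots,X_r|_q$ are linearly independent at every point $q\in U$. For a germ $f$ of complex-valued smooth function at $p_0$ and an integer $k\ge 0$, write $\mathcal D^k(f)(p_0)=0$ if $Y_k(Y_{k-1}(\cdots Y_1(f)\cdots))(p_0)=0$ for all $Y_1,\dots,Y_k\in\mathcal D$ (for $k=0$ this means $f(p_0)=0$). The order of vanishing of $f$ along $\mathcal D$ at $p_0$, denoted $\nu_{\mathcal D}(f)(p_0)\in\{0,1,2,\dots\}\cup\{\infty\}$, is $m$ if $\mathcal D^k(f)(p_0)=0$ for all $k<m$ and, when $m<\infty$, $\mathcal D^m(f)(p_0)\ne0$, i.e. $Y_m(\cdots(Y_1(f))\cdots)(p_0)\neq 0$ for some $Y_1,\dots,Y_m\in\mathcal D$. The usual convention $a+\infty=\infty$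 is used. Inequalities between germs are understood to hold in a neighborhood of $p_0$. *)

theory Defs
  imports "HOL-Analysis.Analysis" "HOL-Library.Extended_Nat"
begin

text \<open>
  On an open subset of a finite-dimensional space, this is equivalent to the existence and
  continuity of all partial derivatives of order at most \<open>k\<close>. It is only meant for open \<open>S\<close>,
  since the derivatives are two-sided.
\<close>

primrec Ck_on :: "nat \<Rightarrow> 'a::real_normed_vector set \<Rightarrow> ('a \<Rightarrow> 'b::real_normed_vector) \<Rightarrow> bool" where
  "Ck_on 0 S f \<longleftrightarrow> continuous_on S f"
| "Ck_on (Suc k) S f \<longleftrightarrow>
     (\<forall>x\<in>S. f differentiable (at x)) \<and>
     (\<forall>v. Ck_on k S (\<lambda>x. frechet_derivative f (at x) v))"

definition smooth_on :: "'a::real_normed_vector set \<Rightarrow> ('a \<Rightarrow> 'b::real_normed_vector) \<Rightarrow> bool" where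
  "smooth_on S f \<longleftrightarrow> (\<forall>k. Ck_on k S f)"

text \<open>
  Germs at \<open>p\<close> are handled through representatives: a total function that is smooth on some open
  neighbourhood of \<open>p\<close>, its values elsewhere being irrelevant
  (see \<open>vanishing_order_cong\<close> below).
\<close>

definition represents_smooth_germ ::
    "'a::real_normed_vector \<Rightarrow> ('a \<Rightarrow> 'b::real_normed_vector) \<Rightarrow> bool" where
  "represents_smooth_germ p f \<longleftrightarrow> (\<exists>V. open V \<and> p \<in> V \<and> smooth_on V f)"

text \<open>
  Linear independence of the family \<open>X 1 q, \<dots>, X r q\<close>; injectivity is needed because
  \<open>independent\<close> only sees the set of its values.
\<close>

definition lin_indep_fields_on ::
    "(real^'n) set \<Rightarrow> nat \<Rightarrow> (nat \<Rightarrow> real^'n \<Rightarrow> real^'n) \<Rightarrow> bool" where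
  "lin_indep_fields_on U r X \<longleftrightarrow>
     (\<forall>q\<in>U. inj_on (\<lambda>i. X i q) {1..r} \<and> independent ((\<lambda>i. X i q) ` {1..r}))"

text \<open>Vector fields are total functions of which only the restriction to \<open>U\<close> matters.\<close>

definition generated_module ::
    "(real^'n) set \<Rightarrow> nat \<Rightarrow> (nat \<Rightarrow> real^'n \<Rightarrow> real^'n) \<Rightarrow> (real^'n \<Rightarrow> real^'n) set" where
  "generated_module U r X =
     {Y. \<exists>a :: nat \<Rightarrow> real^'n \<Rightarrow> real.
           (\<forall>i\<in>{1..r}. smooth_on U (a i)) \<and>
           (\<forall>q\<in>U. Y q = (\<Sum>i=1..r. a i q *\<^sub>R X i q))}"

definition field_deriv ::
    "(real^'n \<Rightarrow> real^'n) \<Rightarrow> (real^'n \<Rightarrow> complex) \<Rightarrow> (real^'n \<Rightarrow> complex)" where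
  "field_deriv Y f = (\<lambda>q. frechet_derivative f (at q) (Y q))"

text \<open>Note that \<open>fold field_deriv [Y1, \<dots>, Yk] f\<close> is \<open>Yk (\<dots> (Y1 f))\<close>.\<close>

definition derivs_vanish ::
    "(real^'n \<Rightarrow> real^'n) set \<Rightarrow> nat \<Rightarrow> (real^'n \<Rightarrow> complex) \<Rightarrow> real^'n \<Rightarrow> bool" where
  "derivs_vanish D k f p \<longleftrightarrow>
     (\<forall>Ys. length Ys = k \<and> set Ys \<subseteq> D \<longrightarrow> fold field_deriv Ys f p = 0)"

definition vanishing_order ::
    "(real^'n \<Rightarrow> real^'n) set \<Rightarrow> (real^'n \<Rightarrow> complex) \<Rightarrow> real^'n \<Rightarrow> enat" where
  "vanishing_order D f p =
     (if \<exists>k. \<not> derivs_vanish D k f p then enat (LEAST k. \<not> derivs_vanish D k f p) else \<infinity>)"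

lemma vanishing_order_eq_enat_iff:
  "vanishing_order D f p = enat m \<longleftrightarrow>
     (\<forall>k<m. derivs_vanish D k f p) \<and> \<not> derivs_vanish D m f p"
proof
  assume "vanishing_order D f p = enat m"
  then have ex: "\<exists>k. \<not> derivs_vanish D k f p" and m: "m = (LEAST k. \<not> derivs_vanish D k f p)"
    by (auto simp: vanishing_order_def split: if_splits)
  show "(\<forall>k<m. derivs_vanish D k f p) \<and> \<not> derivs_vanish D m f p"
    using LeastI_ex[OF ex] not_less_Least m by blast
next
  assume *: "(\<forall>k<m. derivs_vanish D k f p) \<and> \<not> derivs_vanish D m f p"
  then have "(LEAST k. \<not> derivs_vanish D k f p) = m"
    by (intro Least_equality) (auto simp: not_less[symmetric])
  with * show "vanishing_order D f p = enat m"
    by (auto simp: vanishing_order_def)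
qed

lemma vanishing_order_eq_infinity_iff:
  "vanishing_order D f p = \<infinity> \<longleftrightarrow> (\<forall>k. derivs_vanish D k f p)"
  by (auto simp: vanishing_order_def)

lemma field_deriv_cong:
  assumes "\<forall>\<^sub>F q in nhds p. f q = g q"
  shows "\<forall>\<^sub>F q in nhds p. field_deriv Y f q = field_deriv Y g q"
proof -
  obtain V where V: "open V" "p \<in> V" "\<And>q. q \<in> V \<Longrightarrow> f q = g q"
    using assms by (auto simp: eventually_nhds)
  have "field_deriv Y f q = field_deriv Y g q" if "q \<in> V" for q
  proof -
    have "(f has_derivative L) (at q) \<longleftrightarrow> (g has_derivative L) (at q)" for L
      using has_derivative_transform_within_open[OF _ V(1) that, of f L UNIV g]
        has_derivative_transform_within_open[OF _ V(1) that, of g L UNIV f] V(3) by auto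
    then show ?thesis
      by (simp add: field_deriv_def frechet_derivative_def)
  qed
  then show ?thesis
    using V by (auto simp: eventually_nhds)
qed

lemma vanishing_order_cong:
  assumes "\<forall>\<^sub>F q in nhds p. f q = g q"
  shows "vanishing_order D f p = vanishing_order D g p"
proof -
  have "\<forall>\<^sub>F q in nhds p. fold field_deriv Ys f q = fold field_deriv Ys g q" for Ys
    using assms by (induction Ys arbitrary: f g) (auto intro: field_deriv_cong)
  then have "fold field_deriv Ys f p = fold field_deriv Ys g p" for Ys
    by (rule eventually_nhds_x_imp_x)
  then show ?thesis
    by (simp add: vanishing_order_def derivs_vanish_def)
qed

end

theory Submission
  imports Defs "HOL-Library.Sublist" "HOL-Computational_Algebra.Polynomial"
begin

text \<open>
  The idea is to measure the order of vanishing along \<open>D\<close> by curves. A curve \<open>q\<close> is built by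
  following integral curves of fields \<open>Y\<^sub>1, \<dots>, Y\<^sub>l\<close> in \<open>D\<close> one after the other from \<open>p\<close>, the
  \<open>i\<close>-th one for time \<open>s t\<^sub>i\<close>. Taylor's formula along each of them shows that, for a function \<open>F\<close>
  of order at least \<open>m\<close>, the quotient \<open>F (q s) / s^m\<close> converges as \<open>s \<longlongrightarrow> 0\<close>, and the limit is a
  polynomial in \<open>t\<^sub>1, \<dots>, t\<^sub>l\<close> whose coefficients are multiples of iterated derivatives of
  length \<open>m\<close> of \<open>F\<close> at \<open>p\<close> (\<open>exists_curve_with_flow_coeffs\<close>). If \<open>F\<close> has order exactly \<open>m\<close>, then
  some word \<open>Y\<^sub>1 (\<cdots> (Y\<^sub>m F))\<close> in the fields of \<open>D\<close> does not vanish at \<open>p\<close>; it is the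
  coefficient of \<open>t\<^sub>1 \<cdots> t\<^sub>m\<close> when its letters are followed from \<open>Y\<^sub>1\<close> to \<open>Y\<^sub>m\<close>, so the polynomial
  is not zero and generic times give a nonzero limit. Following the letters of one word for \<open>f\<close>
  and of another for \<open>g\<close>, with generic times, produces a single curve that detects both orders
  (\<open>exists_test_curve\<close>): \<open>f (q s) \<sim> c s^a\<close> and \<open>g (q s) \<sim> d s^b\<close> with nonzero \<open>c\<close> and \<open>d\<close>, while \<open>F (q s) = o(s^m)\<close> for every \<open>F\<close> of order
  greater than \<open>m\<close>.

  All three claims then become statements about powers of the real variable \<open>s\<close>. The product has
  order at least \<open>a + b\<close> by the Leibniz rule, and no more since \<open>f g \<sim> c d s^(a + b)\<close> along the
  curve. A function of larger order than \<open>f\<close> is \<open>o(s^a)\<close> and cannot dominate \<open>f\<close>. A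
  nonnegative function cannot behave like an odd power of \<open>s\<close>, which changes sign.
\<close>

section \<open>Calculus of smooth functions\<close>

lemma frechet_derivative_eq_on_open:
  assumes "open S" "x \<in> S" "\<And>y. y \<in> S \<Longrightarrow> f y = g y"
  shows "frechet_derivative f (at x) = frechet_derivative g (at x)"
proof -
  have "(f has_derivative L) (at x) \<longleftrightarrow> (g has_derivative L) (at x)" for L
    using has_derivative_transform_within_open[OF _ assms(1,2), of f L UNIV g]
      has_derivative_transform_within_open[OF _ assms(1,2), of g L UNIV f] assms(3) by auto
  then show ?thesis
    by (simp add: frechet_derivative_def)
qed

lemma Ck_on_cong:
  assumes "open S" "\<And>y. y \<in> S \<Longrightarrow> f y = g y" "Ck_on k S f"
  shows "Ck_on k S g"
  using assms(2,3)
proof (induction k arbitrary: f g)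
  case 0
  then show ?case by (metis Ck_on.simps(1) continuous_on_cong)
next
  case (Suc k)
  have "g differentiable (at x)" if "x \<in> S" for x
    using Suc.prems that has_derivative_transform_within_open[OF _ assms(1) that, of f _ UNIV g]
    unfolding differentiable_def by (metis (no_types, lifting) Ck_on.simps(2) differentiable_def)
  moreover have "Ck_on k S (\<lambda>x. frechet_derivative g (at x) v)" for v
    by (rule Suc.IH[of "\<lambda>x. frechet_derivative f (at x) v"])
      (use Suc.prems frechet_derivative_eq_on_open[OF assms(1), of _ f g] in auto)
  ultimately show ?case by simp
qed

lemma Ck_on_Suc_imp_Ck_on: "Ck_on (Suc k) S f \<Longrightarrow> Ck_on k S f"
proof (induction k arbitrary: f)
  case 0
  then show ?case
    by (auto intro!: continuous_at_imp_continuous_on differentiable_imp_continuous_within)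
qed auto

lemma Ck_on_subset: "Ck_on k S f \<Longrightarrow> T \<subseteq> S \<Longrightarrow> Ck_on k T f"
  by (induction k arbitrary: f) (auto intro: continuous_on_subset)

lemma Ck_on_const: "Ck_on k S (\<lambda>x. c)"
  by (induction k arbitrary: c) auto

lemma Ck_on_add:
  assumes "open S" "Ck_on k S f" "Ck_on k S g"
  shows "Ck_on k S (\<lambda>x. f x + g x)"
  using assms(2,3)
proof (induction k arbitrary: f g)
  case 0
  then show ?case by (auto intro: continuous_on_add)
next
  case (Suc k)
  have D: "frechet_derivative (\<lambda>x. f x + g x) (at x) v
      = frechet_derivative f (at x) v + frechet_derivative g (at x) v" if "x \<in> S" for x v
  proof -
    have "((\<lambda>x. f x + g x) has_derivative
        (\<lambda>v. frechet_derivative f (at x) v + frechet_derivative g (at x) v)) (at x)"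
      using Suc.prems that frechet_derivative_works by (intro has_derivative_add) auto
    then show ?thesis by (metis frechet_derivative_at)
  qed
  have "Ck_on k S (\<lambda>x. frechet_derivative (\<lambda>x. f x + g x) (at x) v)" for v
    by (rule Ck_on_cong[OF assms(1), of
          "\<lambda>x. frechet_derivative f (at x) v + frechet_derivative g (at x) v"])
      (use Suc D in auto)
  then show ?case using Suc.prems by (auto intro: differentiable_add)
qed

lemma has_derivative_bilinear:
  assumes "bounded_bilinear mul" "f differentiable (at x)" "g differentiable (at x)"
  shows "((\<lambda>x. mul (f x) (g x)) has_derivative
     (\<lambda>v. mul (f x) (frechet_derivative g (at x) v) + mul (frechet_derivative f (at x) v) (g x))) (at x)"
  by (rule bounded_bilinear.FDERIV[OF assms(1)])
    (use assms(2,3) in \<open>simp_all add: frechet_derivative_works[symmetric]\<close>)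

text \<open>
  One induction covers scalar multiplication, inner product and complex multiplication. The Leibniz
  rule differentiates only one factor at a time, so the undifferentiated factor has to be weakened from
  \<open>k + 1\<close> to \<open>k\<close> continuous derivatives.
\<close>

lemma Ck_on_bilinear:
  assumes "bounded_bilinear mul" "open S" "Ck_on k S f" "Ck_on k S g"
  shows "Ck_on k S (\<lambda>x. mul (f x) (g x))"
  using assms(3,4)
proof (induction k arbitrary: f g)
  case 0
  then show ?case by (auto intro: bounded_bilinear.continuous_on[OF assms(1)])
next
  case (Suc k)
  note D = has_derivative_bilinear[OF assms(1)]
  have "Ck_on k S (\<lambda>x. frechet_derivative (\<lambda>x. mul (f x) (g x)) (at x) v)" for v
  proof (rule Ck_on_cong[OF assms(2)])
    show "Ck_on k S (\<lambda>x. mul (f x) (frechet_derivative g (at x) v) + mul (frechet_derivative f (at x) v) (g x))"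
      using Suc.prems Ck_on_Suc_imp_Ck_on[OF Suc.prems(1)] Ck_on_Suc_imp_Ck_on[OF Suc.prems(2)]
      by (intro Ck_on_add Suc.IH assms(2)) auto
  qed (use Suc.prems in \<open>simp add: frechet_derivative_at[OF D, symmetric]\<close>)
  moreover have "(\<lambda>x. mul (f x) (g x)) differentiable (at x)" if "x \<in> S" for x
    using D[of f x g] Suc.prems that differentiableI by auto
  ultimately show ?case by simp
qed

lemma smooth_on_cong:
  "open S \<Longrightarrow> (\<And>y. y \<in> S \<Longrightarrow> f y = g y) \<Longrightarrow> smooth_on S f \<Longrightarrow> smooth_on S g"
  unfolding smooth_on_def using Ck_on_cong by blast

lemma smooth_on_subset: "smooth_on S f \<Longrightarrow> T \<subseteq> S \<Longrightarrow> smooth_on T f"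
  unfolding smooth_on_def using Ck_on_subset by blast

lemma smooth_on_bilinear:
  "bounded_bilinear mul \<Longrightarrow> open S \<Longrightarrow> smooth_on S f \<Longrightarrow> smooth_on S g
    \<Longrightarrow> smooth_on S (\<lambda>x. mul (f x) (g x))"
  unfolding smooth_on_def using Ck_on_bilinear by blast

lemma smooth_on_const: "smooth_on S (\<lambda>x. c)"
  unfolding smooth_on_def using Ck_on_const by blast

lemma smooth_on_sum:
  assumes "open S" "\<And>i. i \<in> I \<Longrightarrow> smooth_on S (f i)"
  shows "smooth_on S (\<lambda>x. \<Sum>i\<in>I. f i x)"
  using assms(2)
  by (induction I rule: infinite_finite_induct)
    (auto simp: smooth_on_const smooth_on_def Ck_on_const intro!: Ck_on_add[OF assms(1)])

lemma smooth_on_directional_derivative: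
  "smooth_on S f \<Longrightarrow> smooth_on S (\<lambda>x. frechet_derivative f (at x) v)"
  unfolding smooth_on_def using Ck_on.simps(2) by blast

lemma smooth_on_imp_differentiable: "smooth_on S f \<Longrightarrow> x \<in> S \<Longrightarrow> f differentiable (at x)"
  unfolding smooth_on_def using Ck_on.simps(2) by blast

lemma smooth_on_imp_continuous_on: "smooth_on S f \<Longrightarrow> continuous_on S f"
  unfolding smooth_on_def using Ck_on.simps(1) by blast

text \<open>
  Smoothness concerns derivatives in a fixed direction, while here the direction \<open>Y x\<close> varies
  with the point; expanding \<open>Y x\<close> in the standard basis separates the two.
\<close>

lemma smooth_on_field_deriv:
  assumes "open S" "smooth_on S Y" "smooth_on S f"
  shows "smooth_on S (field_deriv Y f)"
proof (rule smooth_on_cong[OF assms(1)])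
  show "smooth_on S (\<lambda>x. \<Sum>b\<in>Basis. (Y x \<bullet> b) *\<^sub>R frechet_derivative f (at x) b)"
    by (intro smooth_on_sum assms(1) smooth_on_bilinear[OF bounded_bilinear_scaleR]
          smooth_on_bilinear[OF bounded_bilinear_inner] smooth_on_const assms
          smooth_on_directional_derivative)
next
  fix x assume "x \<in> S"
  then have "linear (frechet_derivative f (at x))"
    using smooth_on_imp_differentiable[OF assms(3)] linear_frechet_derivative by blast
  then have "frechet_derivative f (at x) (\<Sum>b\<in>Basis. (Y x \<bullet> b) *\<^sub>R b) =
     (\<Sum>b\<in>Basis. (Y x \<bullet> b) *\<^sub>R frechet_derivative f (at x) b)"
    by (simp add: linear_sum linear_cmul)
  then show "(\<Sum>b\<in>Basis. (Y x \<bullet> b) *\<^sub>R frechet_derivative f (at x) b) = field_deriv Y f x"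
    by (simp add: euclidean_representation field_deriv_def)
qed

lemma smooth_on_generated_module:
  assumes "open U" "\<forall>i\<in>{1..r}. smooth_on U (X i)" "Y \<in> generated_module U r X"
  shows "smooth_on U Y"
proof -
  obtain a where a: "\<forall>i\<in>{1..r}. smooth_on U (a i)" "\<forall>q\<in>U. Y q = (\<Sum>i=1..r. a i q *\<^sub>R X i q)"
    using assms(3) unfolding generated_module_def by auto
  show ?thesis
    by (rule smooth_on_cong[OF assms(1), of "\<lambda>q. \<Sum>i=1..r. a i q *\<^sub>R X i q"])
      (use a assms in \<open>auto intro!: smooth_on_sum smooth_on_bilinear[OF bounded_bilinear_scaleR]\<close>)
qed

lemma smooth_on_fold_field_deriv:
  assumes "open S" "\<And>Y. Y \<in> D \<Longrightarrow> smooth_on S Y" "smooth_on S f" "set Ys \<subseteq> D"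
  shows "smooth_on S (fold field_deriv Ys f)"
  using assms(3,4)
  by (induction Ys arbitrary: f) (auto intro!: smooth_on_field_deriv assms(1,2))

section \<open>Local flows\<close>

text \<open>
  The remainder bound follows from the mean value inequality: the derivative of the remainder of
  order \<open>N + 1\<close> for the chain \<open>h\<^sub>0, h\<^sub>1, \<dots>\<close> is the remainder of order \<open>N\<close> for the shifted chain
  \<open>h\<^sub>1, h\<^sub>2, \<dots>\<close>. The bound holds for \<open>t\<close> of either sign, which the parity argument needs.
\<close>

lemma taylor_bound_vector_valued:
  fixes h :: "nat \<Rightarrow> real \<Rightarrow> 'a::real_normed_vector"
  assumes "\<And>k t. k < N \<Longrightarrow> \<bar>t\<bar> < \<delta> \<Longrightarrow> (h k has_vector_derivative h (Suc k) t) (at t)"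
    and "\<And>t. \<bar>t\<bar> < \<delta> \<Longrightarrow> norm (h N t) \<le> C"
    and "\<bar>t\<bar> < \<delta>"
  shows "norm (h 0 t - (\<Sum>k<N. (t ^ k / fact k) *\<^sub>R h k 0)) \<le> C * \<bar>t\<bar> ^ N"
  using assms
proof (induction N arbitrary: h t)
  case 0
  then show ?case by simp
next
  case (Suc N)
  define g where "g = (\<lambda>t. h 0 t - (\<Sum>k<Suc N. (t ^ k / fact k) *\<^sub>R h k 0))"
  define g' where "g' = (\<lambda>t. h 1 t - (\<Sum>k<N. (t ^ k / fact k) *\<^sub>R h (Suc k) 0))"
  have "0 \<le> C" using Suc.prems(2)[OF Suc.prems(3)] norm_ge_zero order_trans by blast
  have g': "norm (g' x) \<le> C * \<bar>x\<bar> ^ N" if "\<bar>x\<bar> < \<delta>" for x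
    unfolding g'_def using Suc.IH[of "\<lambda>k. h (Suc k)" x] Suc.prems(1,2) that by auto
  have g_eq: "g = (\<lambda>t. h 0 t - (h 0 0 + (\<Sum>k<N. (t ^ Suc k / fact (Suc k)) *\<^sub>R h (Suc k) 0)))"
    unfolding g_def by (subst sum.lessThan_Suc_shift) simp
  have term_deriv: "((\<lambda>t. (t ^ Suc k / fact (Suc k)) *\<^sub>R v) has_vector_derivative (x ^ k / fact k) *\<^sub>R v) (at x)"
    for k x and v :: 'a
  proof -
    have "((\<lambda>t::real. t ^ Suc k / fact (Suc k)) has_real_derivative (real (Suc k) * x ^ k / fact (Suc k))) (at x)"
      by (intro derivative_eq_intros) auto
    also have "real (Suc k) * x ^ k / fact (Suc k) = x ^ k / fact k"
      by (simp del: of_nat_Suc add: fact_Suc)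
    finally have "((\<lambda>t::real. t ^ Suc k / fact (Suc k)) has_real_derivative (x ^ k / fact k)) (at x)" .
    then show ?thesis
      by (intro derivative_eq_intros) (auto simp: has_real_derivative_iff_has_vector_derivative)
  qed
  have deriv: "(g has_vector_derivative g' x) (at x)" if "\<bar>x\<bar> < \<delta>" for x
  proof -
    have "(g has_vector_derivative
        h 1 x - (0 + (\<Sum>k<N. (x ^ k / fact k) *\<^sub>R h (Suc k) 0))) (at x)"
      unfolding g_eq using Suc.prems(1)[of 0 x] that
      by (intro has_vector_derivative_diff has_vector_derivative_add has_vector_derivative_const
            has_vector_derivative_sum term_deriv) auto
    then show ?thesis by (simp add: g'_def)
  qed
  have "norm (g t - g 0) \<le> (C * \<bar>t\<bar> ^ N) * norm (t - 0)"
  proof (rule differentiable_bound)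
    show "convex {- \<bar>t\<bar>..\<bar>t\<bar>}" by simp
    fix x assume x: "x \<in> {- \<bar>t\<bar>..\<bar>t\<bar>}"
    then have xd: "\<bar>x\<bar> < \<delta>" "\<bar>x\<bar> \<le> \<bar>t\<bar>" using Suc.prems(3) by auto
    show "(g has_derivative (\<lambda>s. s *\<^sub>R g' x)) (at x within {- \<bar>t\<bar>..\<bar>t\<bar>})"
      using deriv[OF xd(1)] unfolding has_vector_derivative_def
      by (rule has_derivative_at_withinI)
    have "onorm (\<lambda>s. s *\<^sub>R g' x) \<le> norm (g' x)"
      by (rule onorm_bound) (auto simp: mult.commute)
    also have "\<dots> \<le> C * \<bar>x\<bar> ^ N" using g' xd by blast
    also have "\<dots> \<le> C * \<bar>t\<bar> ^ N" using xd \<open>0 \<le> C\<close> by (intro mult_left_mono power_mono) auto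
    finally show "onorm (\<lambda>s. s *\<^sub>R g' x) \<le> C * \<bar>t\<bar> ^ N" .
  qed auto
  moreover have "g 0 = 0" unfolding g_eq by simp
  ultimately show ?case unfolding g_def by (simp add: mult_ac)
qed

text \<open>
  Smoothness is a statement about each directional derivative separately, so a bound on the
  operator norm is assembled from the finitely many derivatives along basis vectors, each of which
  is continuous and hence bounded on the compact ball.
\<close>

lemma smooth_on_imp_lipschitz_on_cball:
  fixes Y :: "'a::euclidean_space \<Rightarrow> 'b::real_normed_vector"
  assumes "smooth_on V Y" "cball p \<rho> \<subseteq> V"
  obtains L where "0 < L" "L-lipschitz_on (cball p \<rho>) Y"
proof -
  let ?D = "\<lambda>x. frechet_derivative Y (at x)"
  have "bounded ((\<lambda>x. \<Sum>b\<in>Basis. norm (?D x b)) ` cball p \<rho>)"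
    by (intro compact_imp_bounded compact_continuous_image compact_cball continuous_intros
          continuous_on_subset[OF smooth_on_imp_continuous_on, OF smooth_on_directional_derivative assms(2)] assms(1))
  then obtain L where L: "0 < L" "\<And>x. x \<in> cball p \<rho> \<Longrightarrow> norm (\<Sum>b\<in>Basis. norm (?D x b)) \<le> L"
    unfolding bounded_pos by blast
  have "norm (Y x - Y y) \<le> L * norm (x - y)" if "x \<in> cball p \<rho>" "y \<in> cball p \<rho>" for x y
  proof (rule differentiable_bound[OF convex_cball _ _ that, of Y ?D])
    fix z assume z: "z \<in> cball p \<rho>"
    then have d: "(Y has_derivative ?D z) (at z)"
      using smooth_on_imp_differentiable[OF assms(1)] assms(2) frechet_derivative_works by blast
    then show "(Y has_derivative ?D z) (at z within cball p \<rho>)"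
      by (rule has_derivative_at_withinI)
    show "onorm (?D z) \<le> L"
    proof (rule onorm_le)
      fix v
      have "norm (?D z v) = norm (?D z (\<Sum>b\<in>Basis. (v \<bullet> b) *\<^sub>R b))"
        by (simp add: euclidean_representation)
      also have "\<dots> = norm (\<Sum>b\<in>Basis. (v \<bullet> b) *\<^sub>R ?D z b)"
        using has_derivative_linear[OF d] by (simp add: linear_sum linear_cmul)
      also have "\<dots> \<le> (\<Sum>b\<in>Basis. norm v * norm (?D z b))"
        by (rule sum_norm_le) (simp add: mult_right_mono Basis_le_norm)
      also have "\<dots> \<le> L * norm v"
        using L(2)[OF z] mult_right_mono[of "\<Sum>b\<in>Basis. norm (?D z b)" L "norm v"]
        by (simp add: sum_distrib_left[symmetric] mult.commute)
      finally show "norm (?D z v) \<le> L * norm v" .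
    qed
  qed
  then have "L-lipschitz_on (cball p \<rho>) Y"
    using L(1) by (intro lipschitz_onI) (auto simp: dist_norm)
  then show ?thesis using that[OF L(1)] by blast
qed

text \<open>
  Picard's theorem: an integral curve is a fixed point of
  \<open>y \<mapsto> (\<lambda>t. q + \<integral>\<^sub>0\<^sup>t G (y s) ds)\<close>. Clamping the time to \<open>[-h, h]\<close> turns this into a self-map of the complete
  space of bounded continuous functions on the whole line.
\<close>

lemma exists_integral_curve_lipschitz:
  fixes G :: "'a::euclidean_space \<Rightarrow> 'a"
  assumes L: "L-lipschitz_on UNIV G" and B: "\<And>x. norm (G x) \<le> B"
    and h: "0 < h" "3 * h * L < 1"
  obtains c where "c 0 = q" "\<And>t. \<bar>t\<bar> < h \<Longrightarrow> (c has_vector_derivative G (c t)) (at t)"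
proof -
  have "0 \<le> L" by (rule lipschitz_on_nonneg[OF L])
  have "0 \<le> B" by (rule order_trans[OF norm_ge_zero B])
  have contG: "continuous_on UNIV G" by (rule lipschitz_on_continuous_on[OF L])
  define cl where "cl = (\<lambda>t::real. max (-h) (min h t))"
  have cl: "cl t \<in> {-h..h}" for t using h by (auto simp: cl_def)
  have clc: "continuous_on UNIV cl" unfolding cl_def by (intro continuous_intros)
  \<comment> \<open>The integral is taken from \<open>-h\<close> and then corrected by its value at \<open>0\<close>, which treats positive and
    negative times alike; the two terms cost the contraction constant \<open>2 h L + h L\<close>.\<close>
  define I where "I = (\<lambda>(y :: real \<Rightarrow> 'a) t. integral {-h..t} (\<lambda>s. G (y s)))"
  have cont: "continuous_on S (\<lambda>s. G (apply_bcontfun y s))" for y :: "real \<Rightarrow>\<^sub>C 'a" and S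
    by (rule continuous_on_compose2[OF contG]) auto
  have int: "(\<lambda>s. G (apply_bcontfun y s)) integrable_on {-h..t}" for y :: "real \<Rightarrow>\<^sub>C 'a" and t
    by (rule integrable_continuous_interval[OF cont])
  have Ideriv: "(I (apply_bcontfun y) has_vector_derivative G (apply_bcontfun y t)) (at t within {-h..h})"
    if "t \<in> {-h..h}" for y :: "real \<Rightarrow>\<^sub>C 'a" and t
    unfolding I_def by (rule integral_has_vector_derivative[OF cont that])
  have Ibound: "norm (I (apply_bcontfun y) t) \<le> B * (2 * h)" if "t \<in> {-h..h}" for y :: "real \<Rightarrow>\<^sub>C 'a" and t
  proof -
    have "norm (I (apply_bcontfun y) t) \<le> B * (t - (-h))"
      unfolding I_def by (rule integral_bound) (use that B cont in auto)
    also have "\<dots> \<le> B * (2 * h)" using that \<open>0 \<le> B\<close> by (intro mult_left_mono) auto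
    finally show ?thesis .
  qed
  define P where "P = (\<lambda>y :: real \<Rightarrow>\<^sub>C 'a. \<lambda>t. q + I y (cl t) - I y 0)"
  have Pb: "P y \<in> bcontfun" for y
  proof (rule bcontfun_normI)
    have "continuous_on {-h..h} (I (apply_bcontfun y))"
      by (rule continuous_on_vector_derivative[OF Ideriv])
    then have "continuous_on UNIV (\<lambda>t. I (apply_bcontfun y) (cl t))"
      by (rule continuous_on_compose2[OF _ clc]) (use cl in auto)
    then show "continuous_on UNIV (P y)" unfolding P_def by (intro continuous_intros)
    show "norm (P y t) \<le> norm q + B * (2 * h) + B * (2 * h)" for t
      unfolding P_def using Ibound[OF cl, of y t] Ibound[of 0 y] h
        norm_triangle_ineq4[of "q + I y (cl t)" "I y 0"] norm_triangle_ineq[of q "I y (cl t)"] by auto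
  qed
  define PP where "PP = (\<lambda>y. Bcontfun (P y))"
  have PP: "apply_bcontfun (PP y) = P y" for y
    unfolding PP_def by (rule Bcontfun_inverse[OF Pb])
  have Idiff: "norm (I (apply_bcontfun y) t - I (apply_bcontfun z) t) \<le> L * dist y z * (t + h)"
    if "t \<in> {-h..h}" for y z :: "real \<Rightarrow>\<^sub>C 'a" and t
  proof -
    have "I (apply_bcontfun y) t - I (apply_bcontfun z) t
        = integral {-h..t} (\<lambda>s. G (apply_bcontfun y s) - G (apply_bcontfun z s))"
      unfolding I_def by (rule integral_diff[symmetric]) (rule int)+
    moreover have "norm (integral {-h..t} (\<lambda>s. G (apply_bcontfun y s) - G (apply_bcontfun z s)))
        \<le> L * dist y z * (t - (-h))"
    proof (rule integral_bound)
      fix s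
      have "dist (G (apply_bcontfun y s)) (G (apply_bcontfun z s)) \<le> L * dist (apply_bcontfun y s) (apply_bcontfun z s)"
        by (rule lipschitz_onD[OF L]) auto
      also have "\<dots> \<le> L * dist y z" using dist_bounded \<open>0 \<le> L\<close> by (intro mult_left_mono)
      finally show "norm (G (apply_bcontfun y s) - G (apply_bcontfun z s)) \<le> L * dist y z"
        by (simp add: dist_norm)
    qed (use that cont in \<open>auto intro!: continuous_on_diff\<close>)
    ultimately show ?thesis by simp
  qed
  have contr: "dist (PP y) (PP z) \<le> (3 * h * L) * dist y z" for y z
  proof (rule dist_bound)
    fix t
    have "norm (P y t - P z t) = norm ((I y (cl t) - I z (cl t)) - (I y 0 - I z 0))"
      unfolding P_def by (simp add: algebra_simps)
    also have "\<dots> \<le> L * dist y z * (cl t + h) + L * dist y z * (0 + h)"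
      by (rule order_trans[OF norm_triangle_ineq4 add_mono[OF Idiff[OF cl] Idiff]]) (use h in auto)
    also have "\<dots> \<le> L * dist y z * (2 * h) + L * dist y z * h"
      using cl[of t] \<open>0 \<le> L\<close> by (intro add_mono mult_left_mono) auto
    finally show "dist (apply_bcontfun (PP y) t) (apply_bcontfun (PP z) t) \<le> (3 * h * L) * dist y z"
      unfolding PP by (simp add: dist_norm algebra_simps)
  qed
  obtain y where y: "PP y = y"
    using banach_fix_type[of "3 * h * L" PP] contr h \<open>0 \<le> L\<close> by (meson less_eq_real_def mult_nonneg_nonneg zero_le_numeral)
  have ye: "apply_bcontfun y t = q + I y (cl t) - I y 0" for t
    by (rule fun_cong[OF PP[of y, unfolded y P_def]])
  show ?thesis
  proof
    show "apply_bcontfun y 0 = q" using ye[of 0] h by (simp add: cl_def)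
    fix t :: real assume t: "\<bar>t\<bar> < h"
    then have tin: "t \<in> {-h<..<h}" by auto
    have "(I (apply_bcontfun y) has_vector_derivative G (apply_bcontfun y t)) (at t within {-h<..<h})"
      by (rule has_vector_derivative_within_subset[OF Ideriv]) (use tin in auto)
    then have "(I (apply_bcontfun y) has_vector_derivative G (apply_bcontfun y t)) (at t)"
      using at_within_open[OF tin] by simp
    then have "((\<lambda>t. q + I y t - I y 0) has_vector_derivative G (apply_bcontfun y t)) (at t)"
      by (auto intro!: derivative_eq_intros)
    then show "(apply_bcontfun y has_vector_derivative G (apply_bcontfun y t)) (at t)"
      by (rule has_vector_derivative_transform_within_open[OF _ open_greaterThanLessThan tin])
        (use ye in \<open>auto simp: cl_def\<close>)
  qed
qed

text \<open>
  \<open>\<Phi>\<close> is a bare choice of one integral curve for each point near \<open>p\<close>, with a common lifetime.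
  Uniformity in the starting point comes from elsewhere: the Taylor coefficients of \<open>F\<close> along \<open>\<Phi> q\<close>
  are the values at \<open>q\<close> of the smooth functions \<open>Y^k F\<close>, and the remainder is controlled on the
  compact ball that contains all the curves.
\<close>

lemma local_flow:
  fixes Y :: "'a::euclidean_space \<Rightarrow> 'a"
  assumes "open V" "p \<in> V" "smooth_on V Y"
  obtains \<rho> \<delta> B \<Phi> where "0 < \<rho>" "0 < \<delta>" "cball p \<rho> \<subseteq> V"
    "\<And>q. q \<in> ball p (\<rho> / 2) \<Longrightarrow> \<Phi> q 0 = q"
    "\<And>q t. q \<in> ball p (\<rho> / 2) \<Longrightarrow> \<bar>t\<bar> < \<delta> \<Longrightarrow> (\<Phi> q has_vector_derivative Y (\<Phi> q t)) (at t)"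
    "\<And>q t. q \<in> ball p (\<rho> / 2) \<Longrightarrow> \<bar>t\<bar> < \<delta> \<Longrightarrow> \<Phi> q t \<in> cball p \<rho>"
    "\<And>q t. q \<in> ball p (\<rho> / 2) \<Longrightarrow> \<bar>t\<bar> < \<delta> \<Longrightarrow> dist (\<Phi> q t) q \<le> B * \<bar>t\<bar>"
proof -
  obtain \<rho> where \<rho>: "0 < \<rho>" "cball p \<rho> \<subseteq> V"
    using assms open_contains_cball by blast
  obtain L where L: "0 < L" "L-lipschitz_on (cball p \<rho>) Y"
    using smooth_on_imp_lipschitz_on_cball[OF assms(3) \<rho>(2)] .
  have "bounded (Y ` cball p \<rho>)"
    using smooth_on_imp_continuous_on[OF assms(3)] \<rho>(2)
    by (intro compact_imp_bounded compact_continuous_image) (auto intro: continuous_on_subset)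
  then obtain B where B: "0 < B" "\<And>x. x \<in> cball p \<rho> \<Longrightarrow> norm (Y x) \<le> B"
    unfolding bounded_pos by auto
  \<comment> \<open>Precomposing with the projection onto the ball makes the field globally Lipschitz; the lifetime
    \<open>h\<close> is so short that the curve never leaves the ball, where the two fields agree.\<close>
  define G where "G = (\<lambda>x. Y (closest_point (cball p \<rho>) x))"
  have cp: "closest_point (cball p \<rho>) x \<in> cball p \<rho>" for x
    using \<rho>(1) by (intro closest_point_in_set) auto
  have GB: "norm (G x) \<le> B" for x unfolding G_def using B(2) cp by blast
  have "L-lipschitz_on UNIV G"
  proof (rule lipschitz_onI)
    fix x y
    have "dist (G x) (G y) \<le> L * dist (closest_point (cball p \<rho>) x) (closest_point (cball p \<rho>) y)"
      unfolding G_def using lipschitz_onD[OF L(2) cp cp] .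
    also have "\<dots> \<le> L * dist x y"
      using L(1) \<rho>(1) by (intro mult_left_mono closest_point_lipschitz) auto
    finally show "dist (G x) (G y) \<le> L * dist x y" .
  qed (use L in auto)
  note GL = this
  define h where "h = min (1 / (4 * L)) (\<rho> / (2 * B))"
  have h: "0 < h" "3 * h * L < 1" "B * h \<le> \<rho> / 2"
  proof -
    show "0 < h" unfolding h_def using L B \<rho> by auto
    have "h * L \<le> 1 / (4 * L) * L" unfolding h_def using L by (intro mult_right_mono) auto
    then show "3 * h * L < 1" using L by simp
    have "B * h \<le> B * (\<rho> / (2 * B))" unfolding h_def using B by (intro mult_left_mono) auto
    then show "B * h \<le> \<rho> / 2" using B by simp
  qed
  have "\<exists>c. c 0 = q \<and> (\<forall>t. \<bar>t\<bar> < h \<longrightarrow> (c has_vector_derivative G (c t)) (at t))" for q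
    by (rule exists_integral_curve_lipschitz[OF GL GB h(1,2), of q]) blast
  then have "\<exists>\<Phi>. \<forall>q. \<Phi> q 0 = q \<and> (\<forall>t. \<bar>t\<bar> < h \<longrightarrow> (\<Phi> q has_vector_derivative G (\<Phi> q t)) (at t))"
    by (intro choice allI)
  then obtain \<Phi> where \<Phi>: "\<And>q. \<Phi> q 0 = q"
    "\<And>q t. \<bar>t\<bar> < h \<Longrightarrow> (\<Phi> q has_vector_derivative G (\<Phi> q t)) (at t)"
    by blast
  have dist: "dist (\<Phi> q t) q \<le> B * \<bar>t\<bar>" if "\<bar>t\<bar> < h" for q t
    using taylor_bound_vector_valued[of 1 h "\<lambda>k. if k = 0 then \<Phi> q else (\<lambda>t. G (\<Phi> q t))" B t] \<Phi> GB that
    by (simp add: dist_norm)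
  have in_ball: "\<Phi> q t \<in> cball p \<rho>" if "q \<in> ball p (\<rho> / 2)" "\<bar>t\<bar> < h" for q t
  proof -
    have "B * \<bar>t\<bar> \<le> B * h" using B that by (intro mult_left_mono) auto
    then show ?thesis
      using dist[OF that(2), of q] h(3) that(1) dist_triangle[of p "\<Phi> q t" q] by (simp add: dist_commute)
  qed
  show ?thesis
  proof (rule that[OF \<rho>(1) h(1) \<rho>(2), of \<Phi> B])
    fix q t assume qt: "q \<in> ball p (\<rho> / 2)" "\<bar>t\<bar> < h"
    have "G (\<Phi> q t) = Y (\<Phi> q t)"
      unfolding G_def using in_ball[OF qt] by (simp add: closest_point_self)
    then show "(\<Phi> q has_vector_derivative Y (\<Phi> q t)) (at t)" using \<Phi>(2)[OF qt(2), of q] by simp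
  qed (use \<Phi> dist in_ball in auto)
qed

section \<open>Expansion along concatenated flows\<close>

definition vanishes_below ::
    "(real^'n \<Rightarrow> real^'n) set \<Rightarrow> nat \<Rightarrow> (real^'n \<Rightarrow> complex) \<Rightarrow> real^'n \<Rightarrow> bool" where
  "vanishes_below D m F p \<longleftrightarrow> (\<forall>k<m. derivs_vanish D k F p)"

lemma vanishes_below_iff:
  "vanishes_below D m F p \<longleftrightarrow> (\<forall>Ys. set Ys \<subseteq> D \<longrightarrow> length Ys < m \<longrightarrow> fold field_deriv Ys F p = 0)"
  unfolding vanishes_below_def derivs_vanish_def by auto

lemma vanishes_below_iff_vanishing_order:
  "vanishes_below D m F p \<longleftrightarrow> enat m \<le> vanishing_order D F p"
proof (cases "vanishing_order D F p")
  case (enat n)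
  then have *: "\<forall>k<n. derivs_vanish D k F p" "\<not> derivs_vanish D n F p"
    by (simp_all add: vanishing_order_eq_enat_iff)
  then show ?thesis unfolding vanishes_below_def enat
    by (metis enat_ord_simps(1) less_le_trans not_less)
next
  case infinity
  then have "\<forall>k. derivs_vanish D k F p" using vanishing_order_eq_infinity_iff by blast
  then show ?thesis using infinity by (simp add: vanishes_below_def)
qed

lemma vanishes_below_iterate:
  assumes "vanishes_below D m F p" "Y \<in> D"
  shows "vanishes_below D (m - k) ((field_deriv Y ^^ k) F) p"
  unfolding vanishes_below_iff
proof (intro allI impI)
  fix Ys assume Ys: "set Ys \<subseteq> D" "length Ys < m - k"
  have "set (replicate k Y @ Ys) \<subseteq> D" using assms(2) Ys by (auto simp: set_replicate_conv_if)
  then have "fold field_deriv (replicate k Y @ Ys) F p = 0"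
    using assms(1) Ys unfolding vanishes_below_iff by (metis length_append length_replicate less_diff_conv add.commute)
  then show "fold field_deriv Ys ((field_deriv Y ^^ k) F) p = 0"
    by (simp add: fold_replicate)
qed

lemma smooth_on_iterate:
  assumes "open V" "smooth_on V Y" "smooth_on V F"
  shows "smooth_on V ((field_deriv Y ^^ k) F)"
  by (induction k) (auto intro: smooth_on_field_deriv assms)

text \<open>
  For \<open>L = [(Y\<^sub>1, t\<^sub>1), \<dots>, (Y\<^sub>l, t\<^sub>l)]\<close> this is the coefficient of \<open>s^m\<close> in the formal expansion at \<open>p\<close>
  of \<open>exp (s t\<^sub>l Y\<^sub>l) \<cdots> exp (s t\<^sub>1 Y\<^sub>1) F\<close>, a polynomial in the times whose coefficients are multiples of
  the iterated derivatives of \<open>F\<close> of length \<open>m\<close>. The head of the list is the flow that is followed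
  last: its field is the first one to differentiate \<open>F\<close>, in agreement with the order in
  \<open>fold field_deriv\<close>.
\<close>

primrec flow_coeff ::
    "real^'n \<Rightarrow> ((real^'n \<Rightarrow> real^'n) \<times> real) list \<Rightarrow> nat \<Rightarrow> (real^'n \<Rightarrow> complex) \<Rightarrow> complex" where
  "flow_coeff p [] m F = (if m = 0 then F p else 0)"
| "flow_coeff p (W # L) m F =
     (\<Sum>k\<le>m. of_real (snd W ^ k / fact k) * flow_coeff p L (m - k) ((field_deriv (fst W) ^^ k) F))"

lemma has_vector_derivative_along_integral_curve:
  assumes "smooth_on V F" "c t \<in> V" "(c has_vector_derivative Y (c t)) (at t)"
  shows "((\<lambda>t. F (c t)) has_vector_derivative field_deriv Y F (c t)) (at t)"
proof -
  have F: "(F has_derivative frechet_derivative F (at (c t))) (at (c t))"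
    using smooth_on_imp_differentiable[OF assms(1,2)] frechet_derivative_works by blast
  have "((\<lambda>t. F (c t)) has_derivative (\<lambda>h. frechet_derivative F (at (c t)) (h *\<^sub>R Y (c t)))) (at t)"
    by (rule has_derivative_compose[OF assms(3)[unfolded has_vector_derivative_def] F])
  moreover have "frechet_derivative F (at (c t)) (h *\<^sub>R Y (c t)) = h *\<^sub>R field_deriv Y F (c t)" for h
    unfolding field_deriv_def by (rule linear_cmul[OF has_derivative_linear[OF F]])
  ultimately show ?thesis unfolding has_vector_derivative_def by simp
qed

lemma taylor_bound_along_integral_curve:
  assumes "open V" "smooth_on V Y" "smooth_on V F"
    and "\<And>t. \<bar>t\<bar> < \<delta> \<Longrightarrow> (c has_vector_derivative Y (c t)) (at t)"
    and "\<And>t. \<bar>t\<bar> < \<delta> \<Longrightarrow> c t \<in> K" "K \<subseteq> V"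
    and "\<And>x. x \<in> K \<Longrightarrow> norm ((field_deriv Y ^^ N) F x) \<le> C"
    and "\<bar>t\<bar> < \<delta>"
  shows "norm (F (c t) - (\<Sum>k<N. (t ^ k / fact k) *\<^sub>R (field_deriv Y ^^ k) F (c 0))) \<le> C * \<bar>t\<bar> ^ N"
proof -
  have "((\<lambda>t. (field_deriv Y ^^ k) F (c t)) has_vector_derivative (field_deriv Y ^^ Suc k) F (c t)) (at t)"
    if "\<bar>t\<bar> < \<delta>" for k t
    using has_vector_derivative_along_integral_curve[OF smooth_on_iterate[OF assms(1-3)], of c t Y k]
      assms(4-6) that by auto
  then show ?thesis
    using taylor_bound_vector_valued[of N \<delta> "\<lambda>k t. (field_deriv Y ^^ k) F (c t)" C t] assms(5,7,8) by auto
qed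

text \<open>
  The point \<open>q s\<close> is reached from \<open>p\<close> by following the fields of \<open>L\<close> one after the other, each
  for \<open>s\<close> times its assigned time. If \<open>q\<close> works for \<open>L\<close> and a further flow of \<open>Y\<close> for
  time \<open>s \<tau>\<close> leads to \<open>q' s\<close>, then Taylor's formula gives
  \<open>F (q' s) = (\<Sum>k\<le>m. (s \<tau>)^k / k! * (Y^k F) (q s)) + O(s^(m+1))\<close>. Since \<open>Y^k F\<close> vanishes below
  order \<open>m - k\<close>, the induction hypothesis gives the limit of \<open>(Y^k F) (q s) / s^(m - k)\<close>. One curve
  serves all functions simultaneously, which is what allows different functions to be compared.
\<close>

lemma exists_curve_with_flow_coeffs:
  fixes p :: "real^'n"
  assumes "open V" "p \<in> V" "\<And>Y. Y \<in> D \<Longrightarrow> smooth_on V Y" "fst ` set L \<subseteq> D"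
  shows "\<exists>q::real \<Rightarrow> real^'n. (q \<longlongrightarrow> p) (at 0) \<and>
     (\<forall>F m. smooth_on V F \<longrightarrow> vanishes_below D m F p \<longrightarrow>
        ((\<lambda>s. F (q s) / of_real s ^ m) \<longlongrightarrow> flow_coeff p L m F) (at 0))"
  using assms(4)
proof (induction L)
  case Nil
  have "F p / of_real s ^ m = flow_coeff p [] m F" if "vanishes_below D m F p" for F m and s :: real
    using that[unfolded vanishes_below_iff, rule_format, of "[]"] by auto
  then show ?case by (intro exI[of _ "\<lambda>s. p"]) (auto simp del: flow_coeff.simps)
next
  case (Cons W L)
  obtain Y \<tau> where W: "W = (Y, \<tau>)" by force
  have Y: "Y \<in> D" "smooth_on V Y" using Cons.prems assms(3) W by auto
  obtain q where q: "(q \<longlongrightarrow> p) (at 0)"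
    "\<And>F m. smooth_on V F \<Longrightarrow> vanishes_below D m F p \<Longrightarrow>
        ((\<lambda>s. F (q s) / of_real s ^ m) \<longlongrightarrow> flow_coeff p L m F) (at 0)"
    using Cons by auto
  obtain \<rho> \<delta> B \<Phi> where fl: "0 < \<rho>" "0 < \<delta>" "cball p \<rho> \<subseteq> V"
    and \<Phi>0: "\<And>q. q \<in> ball p (\<rho> / 2) \<Longrightarrow> \<Phi> q 0 = q"
    and \<Phi>d: "\<And>q t. q \<in> ball p (\<rho> / 2) \<Longrightarrow> \<bar>t\<bar> < \<delta> \<Longrightarrow> (\<Phi> q has_vector_derivative Y (\<Phi> q t)) (at t)"
    and \<Phi>b: "\<And>q t. q \<in> ball p (\<rho> / 2) \<Longrightarrow> \<bar>t\<bar> < \<delta> \<Longrightarrow> \<Phi> q t \<in> cball p \<rho>"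
    and \<Phi>c: "\<And>q t. q \<in> ball p (\<rho> / 2) \<Longrightarrow> \<bar>t\<bar> < \<delta> \<Longrightarrow> dist (\<Phi> q t) q \<le> B * \<bar>t\<bar>"
    using local_flow[OF assms(1,2) Y(2)] by metis
  have "((\<lambda>s::real. s * \<tau>) \<longlongrightarrow> 0 * \<tau>) (at 0)" by (intro tendsto_intros)
  then have "\<forall>\<^sub>F s in at 0. dist (s * \<tau>) 0 < \<delta>"
    using fl(2) by (intro tendstoD) auto
  moreover have "\<forall>\<^sub>F s in at 0. dist (q s) p < \<rho> / 2"
    using fl(1) by (intro tendstoD[OF q(1)]) auto
  moreover have "\<forall>\<^sub>F s in at (0::real). s \<noteq> 0" by (rule eventually_neq_at_within)
  ultimately have ev: "\<forall>\<^sub>F s in at 0. q s \<in> ball p (\<rho> / 2) \<and> \<bar>s * \<tau>\<bar> < \<delta> \<and> s \<noteq> 0"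
    by eventually_elim (auto simp: dist_commute)
  \<comment> \<open>\<open>q'\<close> still converges to \<open>p\<close>, as the flow displaces \<open>q s\<close> by at most \<open>B\<close> times \<open>\<bar>s * \<tau>\<bar>\<close>.\<close>
  define q' where "q' = (\<lambda>s. \<Phi> (q s) (s * \<tau>))"
  have "((\<lambda>s. dist (q' s) p) \<longlongrightarrow> 0) (at 0)"
  proof (rule Lim_null_comparison)
    show "\<forall>\<^sub>F s in at 0. norm (dist (q' s) p) \<le> B * \<bar>s * \<tau>\<bar> + dist (q s) p"
      using ev unfolding q'_def
    proof eventually_elim
      case (elim s)
      then show ?case using \<Phi>c[of "q s" "s * \<tau>"] dist_triangle[of "\<Phi> (q s) (s * \<tau>)" p "q s"] by simp
    qed
    have "((\<lambda>s. B * \<bar>s * \<tau>\<bar> + dist (q s) p) \<longlongrightarrow> B * \<bar>0 * \<tau>\<bar> + dist p p) (at 0)"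
      by (intro tendsto_intros q)
    then show "((\<lambda>s. B * \<bar>s * \<tau>\<bar> + dist (q s) p) \<longlongrightarrow> 0) (at 0)" by simp
  qed
  then have "(q' \<longlongrightarrow> p) (at 0)" using tendsto_dist_iff by blast
  moreover have "((\<lambda>s. F (q' s) / of_real s ^ m) \<longlongrightarrow> flow_coeff p (W # L) m F) (at 0)"
    if F: "smooth_on V F" "vanishes_below D m F p" for F m
  proof -
    let ?F = "\<lambda>k. (field_deriv Y ^^ k) F"
    let ?S = "\<lambda>s. \<Sum>k\<le>m. of_real (\<tau> ^ k / fact k) * (?F k (q s) / of_real s ^ (m - k))"
    have "bounded (?F (Suc m) ` cball p \<rho>)"
      by (intro compact_imp_bounded compact_continuous_image compact_cball
          continuous_on_subset[OF smooth_on_imp_continuous_on fl(3)] smooth_on_iterate assms(1) Y F)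
    then obtain C where C: "\<And>x. x \<in> cball p \<rho> \<Longrightarrow> norm (?F (Suc m) x) \<le> C"
      unfolding bounded_iff by blast
    have S: "(?S \<longlongrightarrow> flow_coeff p (W # L) m F) (at 0)"
      unfolding W flow_coeff.simps fst_conv snd_conv
      by (intro tendsto_sum tendsto_mult_left q(2) smooth_on_iterate vanishes_below_iterate assms(1) Y F)
    have "((\<lambda>s. F (q' s) / of_real s ^ m - ?S s) \<longlongrightarrow> 0) (at 0)"
    proof (rule Lim_null_comparison)
      show "\<forall>\<^sub>F s in at 0. norm (F (q' s) / of_real s ^ m - ?S s) \<le> C * \<bar>\<tau>\<bar> ^ Suc m * \<bar>s\<bar>"
        using ev
      proof eventually_elim
        case (elim s)
        let ?T = "\<Sum>k<Suc m. ((s * \<tau>) ^ k / fact k) *\<^sub>R ?F k (q s)"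
        have "?T = of_real s ^ m * ?S s"
          unfolding sum_distrib_left lessThan_Suc_atMost
        proof (rule sum.cong)
          fix k assume "k \<in> {..m}"
          then have "(of_real s :: complex) ^ m = of_real s ^ k * of_real s ^ (m - k)"
            by (simp flip: power_add)
          then show "((s * \<tau>) ^ k / fact k) *\<^sub>R ?F k (q s)
              = of_real s ^ m * (of_real (\<tau> ^ k / fact k) * (?F k (q s) / of_real s ^ (m - k)))"
            using elim by (simp add: scaleR_conv_of_real power_mult_distrib)
        qed simp
        then have "F (q' s) / of_real s ^ m - ?S s = (F (q' s) - ?T) / of_real s ^ m"
          using elim by (simp add: field_simps)
        then have "norm (F (q' s) / of_real s ^ m - ?S s) = norm (F (q' s) - ?T) / \<bar>s\<bar> ^ m"
          by (simp add: norm_divide norm_power)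
        also have "\<dots> \<le> C * \<bar>s * \<tau>\<bar> ^ Suc m / \<bar>s\<bar> ^ m"
          using taylor_bound_along_integral_curve[OF assms(1) Y(2) F(1), of \<delta> "\<Phi> (q s)" "cball p \<rho>" "Suc m" C "s * \<tau>"]
            \<Phi>d \<Phi>b C fl(3) elim \<Phi>0[of "q s"] unfolding q'_def by (intro divide_right_mono) auto
        also have "\<dots> = C * \<bar>\<tau>\<bar> ^ Suc m * \<bar>s\<bar>"
          using elim by (simp add: abs_mult power_mult_distrib field_simps)
        finally show ?case .
      qed
      have "((\<lambda>s. C * \<bar>\<tau>\<bar> ^ Suc m * \<bar>s\<bar>) \<longlongrightarrow> C * \<bar>\<tau>\<bar> ^ Suc m * \<bar>0\<bar>) (at (0::real))"
        by (intro tendsto_intros)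
      then show "((\<lambda>s. C * \<bar>\<tau>\<bar> ^ Suc m * \<bar>s\<bar>) \<longlongrightarrow> 0) (at (0::real))" by simp
    qed
    from tendsto_add[OF this S] show ?thesis by simp
  qed
  ultimately show ?case by blast
qed

section \<open>Curves that detect the vanishing order\<close>

lemma exists_common_nonroot:
  assumes "P \<noteq> (0::complex poly)" "Q \<noteq> (0::complex poly)"
  obtains \<tau> :: real where "poly P (of_real \<tau>) \<noteq> 0" "poly Q (of_real \<tau>) \<noteq> 0"
proof -
  have "finite {x. poly (P * Q) x = 0}" using assms by (intro poly_roots_finite) auto
  moreover have "infinite (range (of_real :: real \<Rightarrow> complex))"
    by (simp add: finite_image_iff inj_of_real infinite_UNIV_char_0)
  ultimately have "\<not> range (of_real :: real \<Rightarrow> complex) \<subseteq> {x. poly (P * Q) x = 0}"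
    using finite_subset by blast
  then obtain \<tau> :: real where "poly (P * Q) (of_real \<tau>) \<noteq> 0" by auto
  then show ?thesis using that by (auto simp: poly_mult)
qed

text \<open>
  The witness is nonzero because its coefficient at \<open>k0\<close> is, up to \<open>1 / k0!\<close>, the nonzero
  number in the assumption.
\<close>

lemma flow_coeff_Cons_is_polynomial:
  assumes "k0 \<le> m" "flow_coeff p L (m - k0) ((field_deriv W ^^ k0) F) \<noteq> 0"
  obtains P where "P \<noteq> 0" "\<And>\<tau>. flow_coeff p ((W, \<tau>) # L) m F = poly P (of_real \<tau>)"
proof
  define c where "c = (\<lambda>k. of_real (1 / fact k) * flow_coeff p L (m - k) ((field_deriv W ^^ k) F))"
  define P where "P = (\<Sum>k\<le>m. monom (c k) k)"
  have "coeff P k0 = c k0"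
    unfolding P_def coeff_sum coeff_monom using assms(1) by simp
  moreover have "c k0 \<noteq> 0" using assms(2) by (simp add: c_def)
  ultimately show "P \<noteq> 0" by (metis coeff_0)
  show "flow_coeff p ((W, \<tau>) # L) m F = poly P (of_real \<tau>)" for \<tau>
    unfolding P_def c_def poly_sum poly_monom flow_coeff.simps fst_conv snd_conv
    by (rule sum.cong) simp_all
qed

text \<open>
  In the induction over the list of flows, \<open>k\<close> is \<open>1\<close> if the first field is a letter of the
  nonvanishing word, and \<open>0\<close> if that word is spelled by the remaining fields alone.
\<close>

lemma nonvanishing_word_Cons:
  assumes "subseq Us (W # Ws)" "fold field_deriv Us F p \<noteq> 0"
  obtains k Us' where "k \<le> length Us" "subseq Us' Ws" "length Us' = length Us - k"
    "fold field_deriv Us' ((field_deriv W ^^ k) F) p \<noteq> 0"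
proof (cases "\<exists>us. Us = W # us")
  case True
  then obtain us where us: "Us = W # us" by blast
  show ?thesis
    by (rule that[of 1 us]) (use assms us in simp_all)
next
  case False
  then have "subseq Us Ws" using assms(1) by (cases Us) (auto split: if_splits)
  then show ?thesis
    by (intro that[of 0 Us]) (use assms(2) in simp_all)
qed

text \<open>
  Induction over \<open>Ws\<close> keeps everything in one variable: once the remaining times are chosen, both
  coefficients are nonzero polynomials in the time of the head flow, and two nonzero polynomials
  have a common real non-root. Working with subsequences of one list \<open>Ws\<close> lets \<open>F\<close> and \<open>G\<close> have different words
  and still be detected by the same flows.
\<close>

lemma exists_times_flow_coeff_nonzero:
  assumes "subseq Us Ws" "fold field_deriv Us F p \<noteq> 0"
    and "subseq Vs Ws" "fold field_deriv Vs G p \<noteq> 0"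
  shows "\<exists>L. map fst L = Ws \<and> flow_coeff p L (length Us) F \<noteq> 0 \<and> flow_coeff p L (length Vs) G \<noteq> 0"
  using assms
proof (induction Ws arbitrary: Us Vs F G rule: list.induct)
  case Nil
  then show ?case by (cases Us; cases Vs) auto
next
  case (Cons W Ws)
  obtain k Us' where k: "k \<le> length Us" "subseq Us' Ws" "length Us' = length Us - k"
    "fold field_deriv Us' ((field_deriv W ^^ k) F) p \<noteq> 0"
    using nonvanishing_word_Cons[OF Cons.prems(1,2)] .
  obtain l Vs' where l: "l \<le> length Vs" "subseq Vs' Ws" "length Vs' = length Vs - l"
    "fold field_deriv Vs' ((field_deriv W ^^ l) G) p \<noteq> 0"
    using nonvanishing_word_Cons[OF Cons.prems(3,4)] .
  obtain L where L: "map fst L = Ws"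
    "flow_coeff p L (length Us - k) ((field_deriv W ^^ k) F) \<noteq> 0"
    "flow_coeff p L (length Vs - l) ((field_deriv W ^^ l) G) \<noteq> 0"
    using Cons.IH[OF k(2,4) l(2,4)] k(3) l(3) by auto
  obtain P where P: "P \<noteq> 0" "\<And>\<tau>. flow_coeff p ((W, \<tau>) # L) (length Us) F = poly P (of_real \<tau>)"
    using flow_coeff_Cons_is_polynomial[OF k(1) L(2)] by blast
  obtain Q where Q: "Q \<noteq> 0" "\<And>\<tau>. flow_coeff p ((W, \<tau>) # L) (length Vs) G = poly Q (of_real \<tau>)"
    using flow_coeff_Cons_is_polynomial[OF l(1) L(3)] by blast
  obtain \<tau> where "poly P (of_real \<tau>) \<noteq> 0" "poly Q (of_real \<tau>) \<noteq> 0"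
    using exists_common_nonroot[OF P(1) Q(1)] .
  then show ?case using L(1) P(2) Q(2) by (intro exI[of _ "(W, \<tau>) # L"]) (auto simp del: flow_coeff.simps)
qed

text \<open>
  This curve reduces the comparison of orders along \<open>D\<close> to the comparison of powers of one real
  variable \<open>s\<close>. It is obtained by concatenating a word that does not annihilate \<open>f\<close> and one that
  does not annihilate \<open>g\<close>. The last property follows from the expansion one degree higher, as
  \<open>F (q s) / s^(m+1)\<close> is then convergent.
\<close>

lemma exists_test_curve:
  fixes p :: "real^'n"
  assumes "open V" "p \<in> V" "\<And>Y. Y \<in> D \<Longrightarrow> smooth_on V Y" "smooth_on V f" "smooth_on V g"
    and "vanishing_order D f p = enat a" "vanishing_order D g p = enat b"
  obtains q :: "real \<Rightarrow> real^'n" and c d :: complex where "(q \<longlongrightarrow> p) (at 0)"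
    "c \<noteq> 0" "((\<lambda>s. f (q s) / of_real s ^ a) \<longlongrightarrow> c) (at 0)"
    "d \<noteq> 0" "((\<lambda>s. g (q s) / of_real s ^ b) \<longlongrightarrow> d) (at 0)"
    "\<forall>F m. smooth_on V F \<longrightarrow> enat m < vanishing_order D F p \<longrightarrow>
        ((\<lambda>s. F (q s) / of_real s ^ m) \<longlongrightarrow> 0) (at 0)"
proof -
  obtain Us where Us: "length Us = a" "set Us \<subseteq> D" "fold field_deriv Us f p \<noteq> 0"
    using assms(6) unfolding vanishing_order_eq_enat_iff derivs_vanish_def by blast
  obtain Vs where Vs: "length Vs = b" "set Vs \<subseteq> D" "fold field_deriv Vs g p \<noteq> 0"
    using assms(7) unfolding vanishing_order_eq_enat_iff derivs_vanish_def by blast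
  have "subseq Us (Us @ Vs)" "subseq Vs (Us @ Vs)" by (auto simp: list_emb_append2)
  then obtain L where L: "map fst L = Us @ Vs" "flow_coeff p L a f \<noteq> 0" "flow_coeff p L b g \<noteq> 0"
    using exists_times_flow_coeff_nonzero[of Us "Us @ Vs" f p Vs g] Us Vs by auto
  have "fst ` set L \<subseteq> D" using L(1) Us(2) Vs(2) by (metis le_sup_iff set_append set_map)
  from exists_curve_with_flow_coeffs[OF assms(1,2,3) this]
  obtain q :: "real \<Rightarrow> real^'n" where q: "(q \<longlongrightarrow> p) (at 0)"
    "\<And>F m. smooth_on V F \<Longrightarrow> vanishes_below D m F p \<Longrightarrow>
        ((\<lambda>s. F (q s) / of_real s ^ m) \<longlongrightarrow> flow_coeff p L m F) (at 0)"
    by blast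
  show ?thesis
  proof (rule that[OF q(1) L(2) _ L(3)])
    show "((\<lambda>s. f (q s) / of_real s ^ a) \<longlongrightarrow> flow_coeff p L a f) (at 0)"
      "((\<lambda>s. g (q s) / of_real s ^ b) \<longlongrightarrow> flow_coeff p L b g) (at 0)"
      using q(2) assms(4-7) by (auto simp: vanishes_below_iff_vanishing_order)
  next
    show "\<forall>F m. smooth_on V F \<longrightarrow> enat m < vanishing_order D F p \<longrightarrow>
        ((\<lambda>s. F (q s) / of_real s ^ m) \<longlongrightarrow> 0) (at 0)"
    proof (intro allI impI)
      fix F m assume F: "smooth_on V F" "enat m < vanishing_order D F p"
      then have "vanishes_below D (Suc m) F p"
        by (simp add: vanishes_below_iff_vanishing_order Suc_ile_eq)
      from q(2)[OF F(1) this]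
      have "((\<lambda>s. of_real s * (F (q s) / of_real s ^ Suc m)) \<longlongrightarrow> of_real 0 * flow_coeff p L (Suc m) F) (at 0)"
        by (intro tendsto_intros)
      moreover have "\<forall>\<^sub>F s in at (0::real). of_real s * (F (q s) / of_real s ^ Suc m) = F (q s) / of_real s ^ m"
        using eventually_neq_at_within[of 0] by eventually_elim auto
      ultimately show "((\<lambda>s. F (q s) / of_real s ^ m) \<longlongrightarrow> 0) (at 0)"
        by (simp add: tendsto_cong)
    qed
  qed
qed

section \<open>Products vanish at least to the sum of the orders\<close>

lemma field_deriv_eq_on_open:
  assumes "open V" "\<And>q. q \<in> V \<Longrightarrow> f q = g q" "q \<in> V"
  shows "field_deriv Y f q = field_deriv Y g q"
  unfolding field_deriv_def using frechet_derivative_eq_on_open[OF assms(1,3), of f g] assms(2) by simp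

lemma fold_field_deriv_eq_on_open:
  assumes "open V" "\<And>q. q \<in> V \<Longrightarrow> f q = g q" "q \<in> V"
  shows "fold field_deriv Ys f q = fold field_deriv Ys g q"
  using assms(2)
proof (induction Ys arbitrary: f g)
  case Nil
  then show ?case using assms(3) by simp
next
  case (Cons Y Ys)
  have "field_deriv Y f q = field_deriv Y g q" if "q \<in> V" for q
    using Cons.prems that by (rule field_deriv_eq_on_open[OF assms(1)])
  from Cons.IH[OF this] show ?case by (simp only: fold_simps)
qed

lemma field_deriv_add:
  assumes "smooth_on V f" "smooth_on V g" "q \<in> V"
  shows "field_deriv Y (\<lambda>q. f q + g q) q = field_deriv Y f q + field_deriv Y g q"
proof -
  have "((\<lambda>q. f q + g q) has_derivative
      (\<lambda>v. frechet_derivative f (at q) v + frechet_derivative g (at q) v)) (at q)"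
    using smooth_on_imp_differentiable[OF assms(1,3)] smooth_on_imp_differentiable[OF assms(2,3)]
    by (intro has_derivative_add) (simp_all only: frechet_derivative_works)
  from frechet_derivative_at[OF this, symmetric] show ?thesis by (simp add: field_deriv_def)
qed

lemma field_deriv_mult:
  assumes "smooth_on V f" "smooth_on V g" "q \<in> V"
  shows "field_deriv Y (\<lambda>q. f q * g q) q = f q * field_deriv Y g q + field_deriv Y f q * g q"
  using frechet_derivative_at[OF has_derivative_bilinear[OF bounded_bilinear_mult
      smooth_on_imp_differentiable[OF assms(1,3)] smooth_on_imp_differentiable[OF assms(2,3)]], symmetric]
  by (simp add: field_deriv_def)

lemma fold_field_deriv_add:
  assumes "open V" "\<And>Y. Y \<in> D \<Longrightarrow> smooth_on V Y" "smooth_on V f" "smooth_on V g"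
    and "set Ys \<subseteq> D" "q \<in> V"
  shows "fold field_deriv Ys (\<lambda>q. f q + g q) q = fold field_deriv Ys f q + fold field_deriv Ys g q"
  using assms(3-5)
proof (induction Ys arbitrary: f g)
  case Nil
  then show ?case by simp
next
  case (Cons Y Ys)
  have "fold field_deriv Ys (field_deriv Y (\<lambda>q. f q + g q)) q
      = fold field_deriv Ys (\<lambda>q. field_deriv Y f q + field_deriv Y g q) q"
    using field_deriv_add[OF Cons.prems(1,2)] by (rule fold_field_deriv_eq_on_open[OF assms(1) _ assms(6)])
  moreover have "Y \<in> D" "set Ys \<subseteq> D" using Cons.prems(3) by auto
  moreover note Cons.IH[OF smooth_on_field_deriv[OF assms(1,2) Cons.prems(1)]
      smooth_on_field_deriv[OF assms(1,2) Cons.prems(2)]]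
  ultimately show ?case by (simp only: fold_simps)
qed

text \<open>
  Each derivative falls on one of the two factors by the Leibniz rule and lowers the order of that
  factor by at most one, so a product of total order \<open>a + b\<close> survives fewer than \<open>a + b\<close> derivatives.
  Truncated subtraction is harmless: if \<open>a = 0\<close>, then the shorter word is still shorter than \<open>b\<close>.
\<close>

lemma vanishes_below_mult:
  assumes "open V" "p \<in> V" "\<And>Y. Y \<in> D \<Longrightarrow> smooth_on V Y" "smooth_on V f" "smooth_on V g"
    and "vanishes_below D a f p" "vanishes_below D b g p"
  shows "vanishes_below D (a + b) (\<lambda>q. f q * g q) p"
  unfolding vanishes_below_iff
proof (intro allI impI)
  fix Ys assume "set Ys \<subseteq> D" "length Ys < a + b"
  then show "fold field_deriv Ys (\<lambda>q. f q * g q) p = 0"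
    using assms(4-7)
  proof (induction Ys arbitrary: f g a b)
    case Nil
    then have "0 < a \<or> 0 < b" by auto
    then have "f p = 0 \<or> g p = 0"
      using Nil(5,6)[unfolded vanishes_below_iff, rule_format, of "[]"] by auto
    then show ?case by auto
  next
    case (Cons Y Ys)
    have Y: "Y \<in> D" "set Ys \<subseteq> D" using Cons.prems(1) by auto
    note sm = smooth_on_field_deriv[OF assms(1) assms(3)[OF Y(1)]]
    note mul = smooth_on_bilinear[OF bounded_bilinear_mult assms(1)]
    have 1: "fold field_deriv Ys (\<lambda>q. f q * field_deriv Y g q) p = 0"
      using vanishes_below_iterate[OF Cons.prems(6) Y(1), of 1] Cons.prems(2)
      by (intro Cons.IH[of a "b - 1"] sm Y(2) Cons.prems(3-5)) simp_all
    have 2: "fold field_deriv Ys (\<lambda>q. field_deriv Y f q * g q) p = 0"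
      using vanishes_below_iterate[OF Cons.prems(5) Y(1), of 1] Cons.prems(2)
      by (intro Cons.IH[of "a - 1" b] sm Y(2) Cons.prems(3,4,6)) simp_all
    have "fold field_deriv Ys (field_deriv Y (\<lambda>q. f q * g q)) p
      = fold field_deriv Ys (\<lambda>q. f q * field_deriv Y g q + field_deriv Y f q * g q) p"
      using field_deriv_mult[OF Cons.prems(3,4)] by (rule fold_field_deriv_eq_on_open[OF assms(1) _ assms(2)])
    also have "\<dots> = 0"
      using fold_field_deriv_add[OF assms(1,3) mul[OF Cons.prems(3) sm[OF Cons.prems(4)]]
          mul[OF sm[OF Cons.prems(3)] Cons.prems(4)] Y(2) assms(2)] by (simp only: 1 2 add_0)
    finally show ?case by simp
  qed
qed

section \<open>Multiplicativity, comparison and parity\<close>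

text \<open>
  If the order of \<open>f g\<close> were larger than \<open>a + b\<close>, then along the test curve \<open>f g / s^(a + b)\<close> would tend
  to \<open>0\<close>, whereas it tends to the product of the two nonzero leading coefficients.
\<close>

lemma vanishing_order_mult:
  fixes p :: "real^'n"
  assumes "open V" "p \<in> V" "\<And>Y. Y \<in> D \<Longrightarrow> smooth_on V Y" "smooth_on V f" "smooth_on V g"
  shows "vanishing_order D (\<lambda>q. f q * g q) p = vanishing_order D f p + vanishing_order D g p"
proof (rule antisym)
  have low: "enat (a + b) \<le> vanishing_order D (\<lambda>q. f q * g q) p"
    if "enat a \<le> vanishing_order D f p" "enat b \<le> vanishing_order D g p" for a b
    using vanishes_below_mult[OF assms, where a = a and b = b] that by (simp only: vanishes_below_iff_vanishing_order)
  have eq_infinity: "x = \<infinity>" if "\<And>m. enat m \<le> x" for x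
    using that[of "Suc (the_enat x)"] by (cases x) auto
  show "vanishing_order D f p + vanishing_order D g p \<le> vanishing_order D (\<lambda>q. f q * g q) p"
  proof -
    consider (finite) a b where "vanishing_order D f p = enat a" "vanishing_order D g p = enat b"
      | (infinite_f) "vanishing_order D f p = \<infinity>" | (infinite_g) "vanishing_order D g p = \<infinity>"
      by (cases "vanishing_order D f p"; cases "vanishing_order D g p") auto
    then show ?thesis
    proof cases
      case finite
      then show ?thesis using low[of a b] by simp
    next
      case infinite_f
      then have "enat m \<le> vanishing_order D (\<lambda>q. f q * g q) p" for m
        using low[of m 0] by (simp add: zero_enat_def[symmetric])
      from eq_infinity[OF this] show ?thesis by simp
    next
      case infinite_g
      then have "enat m \<le> vanishing_order D (\<lambda>q. f q * g q) p" for m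
        using low[of 0 m] by (simp add: zero_enat_def[symmetric])
      from eq_infinity[OF this] show ?thesis by simp
    qed
  qed
  show "vanishing_order D (\<lambda>q. f q * g q) p \<le> vanishing_order D f p + vanishing_order D g p"
  proof (rule ccontr)
    assume "\<not> ?thesis"
    then have less: "vanishing_order D f p + vanishing_order D g p < vanishing_order D (\<lambda>q. f q * g q) p"
      by simp
    then obtain a b where ab: "vanishing_order D f p = enat a" "vanishing_order D g p = enat b"
      by (cases "vanishing_order D f p"; cases "vanishing_order D g p") auto
    obtain q :: "real \<Rightarrow> real^'n" and c d :: complex where q: "(q \<longlongrightarrow> p) (at 0)"
      "c \<noteq> 0" "((\<lambda>s. f (q s) / of_real s ^ a) \<longlongrightarrow> c) (at 0)"
      "d \<noteq> 0" "((\<lambda>s. g (q s) / of_real s ^ b) \<longlongrightarrow> d) (at 0)"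
      "\<forall>F m. smooth_on V F \<longrightarrow> enat m < vanishing_order D F p \<longrightarrow>
        ((\<lambda>s. F (q s) / of_real s ^ m) \<longlongrightarrow> 0) (at 0)"
      by (rule exists_test_curve[OF assms ab]) blast
    have "((\<lambda>s. (f (q s) * g (q s)) / of_real s ^ (a + b)) \<longlongrightarrow> 0) (at 0)"
      using less ab by (intro q(6)[rule_format] smooth_on_bilinear[OF bounded_bilinear_mult] assms) auto
    moreover have "((\<lambda>s. (f (q s) * g (q s)) / of_real s ^ (a + b)) \<longlongrightarrow> c * d) (at 0)"
      using tendsto_mult[OF q(3,5)] by (simp add: power_add)
    ultimately have "c * d = 0" by (intro tendsto_unique[OF trivial_limit_at])
    then show False using q by simp
  qed
qed

text \<open>
  Along a curve on which \<open>f\<close> behaves like \<open>c s^a\<close> with \<open>c \<noteq> 0\<close>, a function of order greater than \<open>a\<close> is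
  \<open>o(s^a)\<close> and cannot dominate \<open>f\<close>.
\<close>

lemma vanishing_order_antimono:
  fixes p :: "real^'n"
  assumes "open V" "p \<in> V" "\<And>Y. Y \<in> D \<Longrightarrow> smooth_on V Y" "smooth_on V f" "smooth_on V g"
    and "\<forall>\<^sub>F q in nhds p. norm (f q) \<le> norm (g q)"
  shows "vanishing_order D g p \<le> vanishing_order D f p"
proof (rule ccontr)
  assume "\<not> ?thesis"
  then have less: "vanishing_order D f p < vanishing_order D g p" by simp
  then obtain a where a: "vanishing_order D f p = enat a"
    by (cases "vanishing_order D f p") auto
  obtain q :: "real \<Rightarrow> real^'n" and c d :: complex where q: "(q \<longlongrightarrow> p) (at 0)"
      "c \<noteq> 0" "((\<lambda>s. f (q s) / of_real s ^ a) \<longlongrightarrow> c) (at 0)"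
      "d \<noteq> 0" "((\<lambda>s. f (q s) / of_real s ^ a) \<longlongrightarrow> d) (at 0)"
      "\<forall>F m. smooth_on V F \<longrightarrow> enat m < vanishing_order D F p \<longrightarrow>
        ((\<lambda>s. F (q s) / of_real s ^ m) \<longlongrightarrow> 0) (at 0)"
    by (rule exists_test_curve[OF assms(1-4,4) a a]) blast
  have "((\<lambda>s. g (q s) / of_real s ^ a) \<longlongrightarrow> 0) (at 0)"
    using less a by (intro q(6)[rule_format] assms(5)) simp
  then have "((\<lambda>s. norm (g (q s) / of_real s ^ a)) \<longlongrightarrow> 0) (at 0)"
    by (rule tendsto_norm_zero)
  moreover have "\<forall>\<^sub>F s in at 0. norm (f (q s) / of_real s ^ a) \<le> norm (g (q s) / of_real s ^ a)"
    using eventually_compose_filterlim[OF assms(6) q(1)]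
    by eventually_elim (auto simp: norm_divide divide_right_mono)
  ultimately have "((\<lambda>s. f (q s) / of_real s ^ a) \<longlongrightarrow> 0) (at 0)"
    by (rule Lim_null_comparison[rotated])
  from tendsto_unique[OF trivial_limit_at this q(3)] show False using q(2) by simp
qed

text \<open>
  The test curve is defined for both signs of \<open>s\<close>. If \<open>m\<close> were odd, a function that behaves like
  \<open>c s^m\<close> with \<open>c \<noteq> 0\<close> would change sign at \<open>s = 0\<close>.
\<close>

lemma even_vanishing_order:
  fixes p :: "real^'n"
  assumes "open V" "p \<in> V" "\<And>Y. Y \<in> D \<Longrightarrow> smooth_on V Y" "smooth_on V f"
    and "\<forall>\<^sub>F q in nhds p. f q \<in> \<real> \<and> 0 \<le> Re (f q)"
    and "vanishing_order D f p = enat m"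
  shows "even m"
proof (rule ccontr)
  assume odd: "odd m"
  obtain q :: "real \<Rightarrow> real^'n" and c d :: complex where q: "(q \<longlongrightarrow> p) (at 0)"
      "c \<noteq> 0" "((\<lambda>s. f (q s) / of_real s ^ m) \<longlongrightarrow> c) (at 0)"
    by (rule exists_test_curve[OF assms(1-4,4,6,6)]) blast
  have ev: "\<forall>\<^sub>F s in at 0. f (q s) \<in> \<real> \<and> 0 \<le> Re (f (q s))"
    using eventually_compose_filterlim[OF assms(5) q(1)] .
  have "\<forall>\<^sub>F s in at 0. Im (f (q s) / of_real s ^ m) = 0"
    using ev by eventually_elim (auto simp: complex_is_Real_iff simp flip: of_real_power)
  then have "Im c = 0"
    using tendsto_unique[OF trivial_limit_at tendsto_Im[OF q(3)] tendsto_eventually] by simp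
  have Re: "((\<lambda>s. Re (f (q s)) / s ^ m) \<longlongrightarrow> Re c) (at 0)"
    using tendsto_Re[OF q(3)] by (simp flip: of_real_power)
  have right: "((\<lambda>s. Re (f (q s)) / s ^ m) \<longlongrightarrow> Re c) (at_right 0)"
    and left: "((\<lambda>s. Re (f (q s)) / s ^ m) \<longlongrightarrow> Re c) (at_left 0)"
    using Re by (auto simp: filterlim_at_split)
  have evr: "\<forall>\<^sub>F s in at_right 0. 0 \<le> Re (f (q s))" and evl: "\<forall>\<^sub>F s in at_left 0. 0 \<le> Re (f (q s))"
    using ev by (auto simp: eventually_at_split elim: eventually_mono)
  have "\<forall>\<^sub>F s in at_right 0. 0 \<le> Re (f (q s)) / s ^ m"
    using evr eventually_at_right_less[of 0] by eventually_elim auto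
  then have "0 \<le> Re c" using tendsto_lowerbound[OF right] by simp
  moreover have "\<forall>\<^sub>F s in at_left (0::real). s < 0"
    by (simp add: eventually_at_filter)
  then have "\<forall>\<^sub>F s in at_left 0. Re (f (q s)) / s ^ m \<le> 0"
    using evl by eventually_elim (use odd in \<open>auto simp: divide_le_0_iff zero_le_power_eq power_le_zero_eq odd_pos\<close>)
  then have "Re c \<le> 0" using tendsto_upperbound[OF left] by simp
  ultimately show False using \<open>Im c = 0\<close> q(2) by (auto simp: complex_eq_iff)
qed

theorem theorem2p2:
  fixes U :: "(real^'n) set" and r :: nat and X :: "nat \<Rightarrow> real^'n \<Rightarrow> real^'n"
    and D :: "(real^'n \<Rightarrow> real^'n) set" and p0 :: "real^'n" and f g :: "real^'n \<Rightarrow> complex"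
  assumes "open U"
    and "\<forall>i\<in>{1..r}. smooth_on U (X i)"
    and "lin_indep_fields_on U r X"
    and "D = generated_module U r X"
    and "p0 \<in> U"
    and "represents_smooth_germ p0 f"
    and "represents_smooth_germ p0 g"
  shows "vanishing_order D (\<lambda>q. f q * g q) p0 = vanishing_order D f p0 + vanishing_order D g p0
    \<and> ((\<forall>\<^sub>F q in nhds p0. f q \<in> \<real> \<and> g q \<in> \<real> \<and> 0 \<le> Re (f q) \<and> Re (f q) \<le> Re (g q))
          \<and> g p0 = f p0
        \<longrightarrow> vanishing_order D f p0 \<ge> vanishing_order D g p0)
    \<and> ((\<forall>\<^sub>F q in nhds p0. f q \<in> \<real> \<and> 0 \<le> Re (f q))
        \<longrightarrow> (\<exists>m. even m \<and> vanishing_order D f p0 = enat m) \<or> vanishing_order D f p0 = \<infinity>)"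
proof -
  obtain Vf where Vf: "open Vf" "p0 \<in> Vf" "smooth_on Vf f"
    using assms(6) unfolding represents_smooth_germ_def by blast
  obtain Vg where Vg: "open Vg" "p0 \<in> Vg" "smooth_on Vg g"
    using assms(7) unfolding represents_smooth_germ_def by blast
  define V where "V = U \<inter> Vf \<inter> Vg"
  have V: "open V" "p0 \<in> V" unfolding V_def using assms(1,5) Vf Vg by auto
  have D: "smooth_on V Y" if "Y \<in> D" for Y
    by (rule smooth_on_subset[OF smooth_on_generated_module[OF assms(1,2)]])
      (use that assms(4) in \<open>auto simp: V_def\<close>)
  have f: "smooth_on V f" and g: "smooth_on V g"
    by (rule smooth_on_subset[OF Vf(3)], auto simp: V_def) (rule smooth_on_subset[OF Vg(3)], auto simp: V_def)
  have "vanishing_order D g p0 \<le> vanishing_order D f p0"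
    if "\<forall>\<^sub>F q in nhds p0. f q \<in> \<real> \<and> g q \<in> \<real> \<and> 0 \<le> Re (f q) \<and> Re (f q) \<le> Re (g q)"
  proof (rule vanishing_order_antimono[OF V D f g])
    show "\<forall>\<^sub>F q in nhds p0. norm (f q) \<le> norm (g q)"
      using that by eventually_elim (simp add: in_Reals_norm)
  qed
  moreover have "(\<exists>m. even m \<and> vanishing_order D f p0 = enat m) \<or> vanishing_order D f p0 = \<infinity>"
    if "\<forall>\<^sub>F q in nhds p0. f q \<in> \<real> \<and> 0 \<le> Re (f q)"
    using even_vanishing_order[OF V D f that] by (cases "vanishing_order D f p0") auto
  ultimately show ?thesis
    using vanishing_order_mult[OF V D f g] by blast
qed

end
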